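(* Let $\mathbf{F}_q$ be a finite field with $q$ elements, $f\in MF_n^n(\mathbf{F}_q)$ a coupled monomial dynamical system and $G_f$ its dependency graph with vertex set $V_f$. Then $f$ is a fixed point system if and only if there is a positive integer $m$ such that the following two conditions hold: 1. For every pair of vertices $a,b\in V_f$ such that there is a sequence of length $m$ from $a$ to $b$, there exists for every positive integer $\lambda$ an integer $a_\lambda\in\mathbb{Z}$ such that $s_{m+\lambda}(a,b)=s_m(a,b)+a_\lambda(q-1)\neq 0$. 2. For every pair of vertices $a,b\in V_f$ with $s_m(a,b)=0$ it holds that $s_{m+\lambda}(a,b)=0$ for all positive integers $\lambda$.
   Context: $E_q=\{0,1,\dots,q-1\}$; convention $x^0=1$ for all $x\in\mathbf{F}_q$. A monomial dynamical system $f\in MF_n^n(\mathbf{F}_q)$ ($n$ a positive integer) is a map $f:\mathbf{F}_q^n\to\mathbf{F}_q^n$ for which there is a (necessarily unique) $n\times n$ matrix $F$ with entries in $E_q$, called the corresponding matrix of $f$, such that $f_i(x)=x_1^{F_{i1}}\cdots x_n^{F_{in}}$ for all $x\in\mathbf{F}_q^n$ and all $i$. $f$ is a fixed point system if every trajectory $x,f(x),f^2(x),\dots$ ends in a fixed point of $f$; equivalently there is $m\ge 1$ with $f^{m+\lambda}=f^m$ for all $\lambda\ge 1$. The dependency graph $G_f$ of $f$ is the directed multigraph (self loops and parallel edges allowed) with vertex set $V_f=\{a_1,\dots,a_n\}$ and exactly $F_{ij}$ directed edges from $a_i$ to $a_j$ for all $i,j$. A sequence of length $s$ from $a$ to $b$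 is a directed walk consisting of $s$ edges (vertices and edges may repeat); two sequences of the same length are different if the edges involved or their order differ (so parallel edges give different sequences). $s_m(a,b)$ is the number of different sequences of length $m$ from $a$ to $b$. Strongly connected components are the usual ones; a strongly connected component is trivial if it consists of a single vertex $a$ and there is no edge $a\to a$. $f$ is coupled if its dependency graph contains nontrivial strongly connected components. *)

theory Defs
  imports
    "HOL-Analysis.Finite_Cartesian_Product"
    "HOL-Computational_Algebra.Polynomial"
    "Graph_Theory.Digraph_Component"
begin

text \<open>
  The finite field is a type of class \<^class>\<open>field\<close> and \<^class>\<open>finite\<close>, so
  \<open>q = CARD('a)\<close>; the coordinates of a state are indexed by a finite type,
  so \<open>n = CARD('n)\<close>. The convention \<open>x\<^sup>0 = 1\<close>, also for \<open>x = 0\<close>, holds for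
  the library's power operation.
\<close>

definition corresponding_matrix ::
    "nat ^ 'n ^ 'n \<Rightarrow> ('a::{field,finite} ^ 'n \<Rightarrow> 'a ^ 'n) \<Rightarrow> bool" where
  "corresponding_matrix F f \<longleftrightarrow>
     (\<forall>i j. F $ i $ j \<in> {0..<CARD('a)}) \<and>
     (\<forall>x i. f x $ i = (\<Prod>j\<in>UNIV. (x $ j) ^ (F $ i $ j)))"

definition MF :: "('a::{field,finite} ^ 'n \<Rightarrow> 'a ^ 'n) set" where
  "MF = {f. \<exists>F. corresponding_matrix F f}"

lemma corresponding_matrix_unique:
  fixes f :: "'a::{field,finite} ^ 'n \<Rightarrow> 'a ^ 'n"
  assumes "corresponding_matrix F f" and "corresponding_matrix G f"
  shows "F = G"
proof -
  have "F $ i $ j = G $ i $ j" for i j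
  proof (rule ccontr)
    assume ne: "F $ i $ j \<noteq> G $ i $ j"
    define p :: "'a poly" where "p = monom 1 (F $ i $ j) - monom 1 (G $ i $ j)"
    have coord: "f (\<chi> k. if k = j then t else 1) $ i = t ^ (H $ i $ j)"
      if "corresponding_matrix H f" for t H
    proof -
      have "f (\<chi> k. if k = j then t else 1) $ i
          = (\<Prod>k\<in>UNIV. (if k = j then t else 1) ^ (H $ i $ k))"
        using that by (simp add: corresponding_matrix_def)
      also have "\<dots> = (\<Prod>k\<in>UNIV. if k = j then t ^ (H $ i $ k) else 1)"
        by (intro prod.cong) auto
      finally show ?thesis by (simp add: prod.delta)
    qed
    have roots: "poly p t = 0" for t
      using coord[OF assms(1), of t] coord[OF assms(2), of t]
      by (simp add: p_def poly_monom)
    have "coeff p (F $ i $ j) = 1"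
      using ne by (simp add: p_def)
    then have "p \<noteq> 0" by auto
    then have "CARD('a) \<le> degree p"
      using card_poly_roots_bound[of p] roots by simp
    moreover have "degree p < CARD('a)"
    proof -
      have "degree p \<le> max (F $ i $ j) (G $ i $ j)"
        unfolding p_def by (meson degree_diff_le degree_monom_le max.coboundedI1
            max.coboundedI2 order_trans)
      also have "\<dots> < CARD('a)"
        using assms by (simp add: corresponding_matrix_def)
      finally show ?thesis .
    qed
    ultimately show False by simp
  qed
  then show ?thesis by (simp add: vec_eq_iff)
qed

definition matrix_of :: "('a::{field,finite} ^ 'n \<Rightarrow> 'a ^ 'n) \<Rightarrow> nat ^ 'n ^ 'n" where
  "matrix_of f = (THE F. corresponding_matrix F f)"

lemma matrix_of_eq: "corresponding_matrix F f \<Longrightarrow> matrix_of f = F"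
  unfolding matrix_of_def using corresponding_matrix_unique by blast

definition fixed_point_system :: "('s \<Rightarrow> 's) \<Rightarrow> bool" where
  "fixed_point_system f \<longleftrightarrow> (\<forall>x. \<exists>k. f ((f ^^ k) x) = (f ^^ k) x)"

text \<open>
  The arc \<open>(i, j, k)\<close> is the \<open>k\<close>-th of the \<open>F\<^sub>i\<^sub>j\<close> parallel arcs from \<open>i\<close> to \<open>j\<close>.
\<close>

definition dependency_graph ::
    "('a::{field,finite} ^ 'n \<Rightarrow> 'a ^ 'n) \<Rightarrow> ('n, 'n \<times> 'n \<times> nat) pre_digraph" where
  "dependency_graph f =
     \<lparr> verts = UNIV,
       arcs = {(i, j, k). k < matrix_of f $ i $ j},
       tail = (\<lambda>(i, j, k). i),
       head = (\<lambda>(i, j, k). j) \<rparr>"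

lemma fin_digraph_dependency_graph: "fin_digraph (dependency_graph f)"
proof
  let ?M = "matrix_of f"
  have "arcs (dependency_graph f) \<subseteq> (\<Union>i. \<Union>j. (\<lambda>k. (i, j, k)) ` {..<?M $ i $ j})"
    by (auto simp: dependency_graph_def)
  then show "finite (arcs (dependency_graph f))"
    by (rule finite_subset) auto
qed (auto simp: dependency_graph_def)

text \<open>
  Sequences are arc walks; a walk is the list of its arcs, so walks through
  different parallel arcs are different.
\<close>

definition sequences :: "('v, 'e) pre_digraph \<Rightarrow> nat \<Rightarrow> 'v \<Rightarrow> 'v \<Rightarrow> 'e list set" where
  "sequences G m a b = {p. pre_digraph.awalk G a p b \<and> length p = m}"

definition num_sequences :: "('v, 'e) pre_digraph \<Rightarrow> nat \<Rightarrow> 'v \<Rightarrow> 'v \<Rightarrow> nat" where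
  "num_sequences G m a b = card (sequences G m a b)"

lemma (in fin_digraph) finite_sequences: "finite (sequences G m a b)"
  by (rule finite_subset[OF _ finite_lists_length_eq[OF finite_arcs, of m]])
    (auto simp: sequences_def awalk_def)

definition trivial_scc :: "('v, 'e) pre_digraph \<Rightarrow> ('v, 'e) pre_digraph \<Rightarrow> bool" where
  "trivial_scc G H \<longleftrightarrow> (\<exists>a. verts H = {a} \<and> \<not> a \<rightarrow>\<^bsub>G\<^esub> a)"

definition coupled :: "('a::{field,finite} ^ 'n \<Rightarrow> 'a ^ 'n) \<Rightarrow> bool" where
  "coupled f \<longleftrightarrow>
     (\<exists>H \<in> pre_digraph.sccs (dependency_graph f). \<not> trivial_scc (dependency_graph f) H)"

end

theory Submission
  imports Defs
begin

text \<open>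
  The matrix of \<open>f\<^sup>m\<close> over the natural numbers is the \<open>m\<close>-th power of \<open>F\<close>, whose entries are the
  numbers \<open>s\<^sub>m(a, b)\<close>. A power map \<open>x \<mapsto> x\<^sup>s\<close> on \<open>\<F>\<^sub>q\<close> determines \<open>s\<close> exactly up to the
  congruence that identifies positive exponents modulo \<open>q - 1\<close> and keeps \<open>0\<close> apart. Hence
  \<open>f\<^sup>m\<^sup>+\<^sup>l = f\<^sup>m\<close> says that \<open>s\<^sub>m\<^sub>+\<^sub>l(a, b)\<close> and \<open>s\<^sub>m(a, b)\<close> are congruent in this sense for all \<open>a, b\<close>.
\<close>

lemma finite_field_power_card_minus_1:
  fixes x :: "'a::{field,finite}"
  assumes "x \<noteq> 0"
  shows "x ^ (CARD('a) - 1) = 1"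
proof -
  let ?U = "UNIV - {0 :: 'a}"
  \<comment> \<open>Multiplication by \<open>x\<close> permutes the nonzero elements, so their
    product \<open>P\<close> satisfies \<open>P = x ^ (q - 1) * P\<close>; as \<open>P\<close> is
    nonzero, it cancels.\<close>
  have "prod (\<lambda>y. y) ?U = (\<Prod>y\<in>?U. x * y)"
    by (rule prod.reindex_bij_witness[of _ "\<lambda>y. x * y" "\<lambda>y. y / x"]) (use assms in auto)
  also have "\<dots> = x ^ (CARD('a) - 1) * prod (\<lambda>y. y) ?U"
    by (simp add: prod.distrib card_Diff_singleton)
  finally show ?thesis by simp
qed

text \<open>The exponent in \<open>{0..<q}\<close> that gives the same power map as \<open>s\<close> on the field with \<open>q\<close> elements.\<close>

definition reduced_exponent :: "nat \<Rightarrow> nat \<Rightarrow> nat" where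
  "reduced_exponent q s = (if s = 0 then 0 else Suc ((s - 1) mod (q - 1)))"

lemma reduced_exponent_less:
  assumes "2 \<le> q"
  shows "reduced_exponent q s < q"
proof -
  have "Suc ((s - 1) mod (q - 1)) < q"
    unfolding Suc_eq_plus1 less_diff_conv[symmetric] using assms by (intro mod_less_divisor) simp
  then show ?thesis
    using assms by (simp add: reduced_exponent_def)
qed

lemma card_field_ge_2: "2 \<le> CARD('a::{field,finite})"
  using card_mono[of UNIV "{0, 1 :: 'a}"] by simp

text \<open>At \<open>x = 0\<close> only the positivity of the exponent matters, and the reduction
  preserves it. For other \<open>x\<close>, one factor is set aside and \<open>s - 1\<close> is
  divided by \<open>q - 1\<close>; the quotient part contributes 1.\<close>

lemma power_reduced_exponent:
  fixes x :: "'a::{field,finite}"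
  shows "x ^ reduced_exponent CARD('a) s = x ^ s"
proof (cases "x = 0 \<or> s = 0")
  case True
  then show ?thesis by (auto simp: reduced_exponent_def)
next
  case False
  let ?q = "CARD('a) - 1"
  have "x ^ s = x * x ^ (?q * ((s - 1) div ?q) + (s - 1) mod ?q)"
    using False by (simp flip: power_Suc)
  also have "\<dots> = x * x ^ ((s - 1) mod ?q)"
    using False by (simp only: power_add power_mult finite_field_power_card_minus_1
        power_one mult_1_left de_Morgan_disj not_False_eq_True)
  finally show ?thesis
    using False by (simp add: reduced_exponent_def)
qed

text \<open>The right-hand side has the shape of the two graph conditions for a single pair of
  vertices. For positive exponents the shift by one cancels, leaving a congruence modulo
  \<open>q - 1\<close>; its multiplier may be negative, hence the integers.\<close>

lemma reduced_exponent_eq_iff: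
  assumes "2 \<le> q"
  shows "reduced_exponent q t = reduced_exponent q s \<longleftrightarrow>
    (s \<noteq> 0 \<longrightarrow> (\<exists>c::int. int t = int s + c * (int q - 1) \<and> t \<noteq> 0)) \<and> (s = 0 \<longrightarrow> t = 0)"
proof (cases "s = 0 \<or> t = 0")
  case True
  then show ?thesis by (auto simp: reduced_exponent_def)
next
  case False
  then obtain s' t' where st: "s = Suc s'" "t = Suc t'"
    by (meson not0_implies_Suc)
  have "t' mod (q - 1) = s' mod (q - 1) \<longleftrightarrow> int t' mod (int q - 1) = int s' mod (int q - 1)"
    using assms by (metis One_nat_def Suc_1 Suc_leD nat_int of_nat_1 of_nat_diff zmod_int)
  also have "\<dots> \<longleftrightarrow> (\<exists>c. int t' = int s' + c * (int q - 1))"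
    by (auto simp: mod_eq_dvd_iff dvd_def algebra_simps)
  finally show ?thesis
    using st by (simp add: reduced_exponent_def add.assoc)
qed

lemma sequences_0: "sequences (dependency_graph f) 0 a b = (if a = b then {[]} else {})"
  unfolding sequences_def pre_digraph.awalk_def
  by (auto simp: dependency_graph_def pre_digraph.cas.simps)

text \<open>Splitting off the first arc, encoded by its head \<open>c\<close> and its index
  \<open>k\<close> among parallel arcs, is injective, so counting yields the recursion for matrix
  powers.\<close>

lemma sequences_Suc:
  "sequences (dependency_graph f) (Suc m) a b =
    (\<lambda>((c, k), p). (a, c, k) # p) `
      (SIGMA (c, k) : (SIGMA c : UNIV. {..<matrix_of f $ a $ c}).
        sequences (dependency_graph f) m c b)"
proof -
  interpret fin_digraph "dependency_graph f"
    by (rule fin_digraph_dependency_graph)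
  have Cons_sequences: "(i, c, k) # p \<in> sequences (dependency_graph f) (Suc m) a b \<longleftrightarrow>
      i = a \<and> k < matrix_of f $ a $ c \<and> p \<in> sequences (dependency_graph f) m c b" for i c k p
    by (auto simp: sequences_def awalk_Cons_iff) (auto simp: dependency_graph_def)
  have nonempty: "p \<noteq> []" if "p \<in> sequences (dependency_graph f) (Suc m) a b" for p
    using that by (auto simp: sequences_def)
  show ?thesis
  proof (intro set_eqI)
    fix p
    show "p \<in> sequences (dependency_graph f) (Suc m) a b \<longleftrightarrow>
      p \<in> (\<lambda>((c, k), p). (a, c, k) # p) `
        (SIGMA (c, k) : (SIGMA c : UNIV. {..<matrix_of f $ a $ c}).
          sequences (dependency_graph f) m c b)"
    proof (cases p)
      case Nil
      then show ?thesis using nonempty by auto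
    next
      case (Cons e p')
      obtain i c k where "e = (i, c, k)" by (cases e)
      with Cons Cons_sequences show ?thesis by (force simp: image_iff)
    qed
  qed
qed

lemma num_sequences_0: "num_sequences (dependency_graph f) 0 a b = (if a = b then 1 else 0)"
  by (simp add: num_sequences_def sequences_0)

lemma num_sequences_Suc:
  "num_sequences (dependency_graph f) (Suc m) a b =
    (\<Sum>c\<in>UNIV. matrix_of f $ a $ c * num_sequences (dependency_graph f) m c b)"
proof -
  let ?S = "sequences (dependency_graph f) m"
  have "num_sequences (dependency_graph f) (Suc m) a b =
      card (SIGMA (c, k) : (SIGMA c : UNIV. {..<matrix_of f $ a $ c}). ?S c b)"
    unfolding num_sequences_def sequences_Suc
    by (rule card_image) (auto simp: inj_on_def)
  also have "\<dots> = (\<Sum>(c, k)\<in>(SIGMA c : UNIV. {..<matrix_of f $ a $ c}). card (?S c b))"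
    by (subst card_SigmaI)
      (auto simp: fin_digraph.finite_sequences[OF fin_digraph_dependency_graph] intro!: sum.cong)
  also have "\<dots> = (\<Sum>c\<in>UNIV. \<Sum>k<matrix_of f $ a $ c. card (?S c b))"
    by (subst sum.Sigma) auto
  finally show ?thesis
    by (simp add: num_sequences_def)
qed

text \<open>Substituting monomials into monomials multiplies exponent matrices. The exponents stay
  unreduced here, so they are exact walk counts.\<close>

lemma funpow_monomial:
  fixes f :: "'a::{field,finite} ^ 'n \<Rightarrow> 'a ^ 'n"
  assumes "f \<in> MF"
  shows "(f ^^ m) x $ a = (\<Prod>b\<in>UNIV. (x $ b) ^ num_sequences (dependency_graph f) m a b)"
proof (induction m arbitrary: a)
  case 0
  have "(\<Prod>b\<in>UNIV. (x $ b) ^ (if a = b then 1 else 0)) = (\<Prod>b\<in>UNIV. if a = b then x $ b else 1)"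
    by (intro prod.cong) auto
  then show ?case by (simp add: num_sequences_0 prod.delta)
next
  case (Suc m)
  let ?s = "num_sequences (dependency_graph f)"
  have "corresponding_matrix (matrix_of f) f"
    using assms matrix_of_eq by (auto simp: MF_def)
  then have "(f ^^ Suc m) x $ a = (\<Prod>c\<in>UNIV. ((f ^^ m) x $ c) ^ (matrix_of f $ a $ c))"
    by (simp add: corresponding_matrix_def)
  also have "\<dots> = (\<Prod>c\<in>UNIV. \<Prod>b\<in>UNIV. (x $ b) ^ (matrix_of f $ a $ c * ?s m c b))"
    by (simp add: Suc.IH prod_power_distrib mult.commute flip: power_mult)
  also have "\<dots> = (\<Prod>b\<in>UNIV. \<Prod>c\<in>UNIV. (x $ b) ^ (matrix_of f $ a $ c * ?s m c b))"
    by (rule prod.swap)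
  finally show ?case
    by (simp add: num_sequences_Suc power_sum)
qed

text \<open>Walk counts may exceed \<open>q - 1\<close>. Reducing them makes uniqueness of the
  corresponding matrix applicable to the iterates.\<close>

lemma corresponding_matrix_funpow:
  fixes f :: "'a::{field,finite} ^ 'n \<Rightarrow> 'a ^ 'n"
  assumes "f \<in> MF"
  shows "corresponding_matrix
    (\<chi> a b. reduced_exponent CARD('a) (num_sequences (dependency_graph f) m a b)) (f ^^ m)"
  by (simp add: corresponding_matrix_def funpow_monomial[OF assms] power_reduced_exponent
      reduced_exponent_less[OF card_field_ge_2])

lemma funpow_eq_iff:
  fixes f :: "'a::{field,finite} ^ 'n \<Rightarrow> 'a ^ 'n"
  assumes "f \<in> MF"
  shows "f ^^ k = f ^^ m \<longleftrightarrow>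
    (\<forall>a b. reduced_exponent CARD('a) (num_sequences (dependency_graph f) k a b) =
      reduced_exponent CARD('a) (num_sequences (dependency_graph f) m a b))"
    (is "_ \<longleftrightarrow> (\<forall>a b. ?r k a b = ?r m a b)")
proof
  assume "f ^^ k = f ^^ m"
  then have "(\<chi> a b. ?r k a b) = (\<chi> a b. ?r m a b)"
    using corresponding_matrix_funpow[OF assms] corresponding_matrix_unique by metis
  then show "\<forall>a b. ?r k a b = ?r m a b"
    by (simp add: vec_eq_iff)
next
  assume r: "\<forall>a b. ?r k a b = ?r m a b"
  have "(f ^^ k) x $ a = (f ^^ m) x $ a" for x a
    using r by (simp add: funpow_monomial[OF assms]) (metis power_reduced_exponent)
  then show "f ^^ k = f ^^ m"
    by (simp add: fun_eq_iff vec_eq_iff)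
qed

lemma fixed_point_system_iff:
  fixes f :: "'s::finite \<Rightarrow> 's"
  shows "fixed_point_system f \<longleftrightarrow> (\<exists>m>0. \<forall>l>0. f ^^ (m + l) = f ^^ m)"
proof
  assume "fixed_point_system f"
  then obtain k where k: "f ((f ^^ k x) x) = (f ^^ k x) x" for x
    unfolding fixed_point_system_def by metis
  have const: "(f ^^ (k x + l)) x = (f ^^ k x) x" for x l
    by (induction l) (simp_all add: k)
  \<comment> \<open>Finiteness of the state space bounds the stopping times uniformly;
    \<open>Suc\<close> makes the bound positive.\<close>
  define m where "m = Suc (Max (range k))"
  have le: "k x \<le> m" for x
    by (simp add: m_def le_SucI)
  have "f ^^ (m + l) = f ^^ m" for l
  proof
    fix x
    show "(f ^^ (m + l)) x = (f ^^ m) x"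
      using const[of x "m + l - k x"] const[of x "m - k x"] le[of x] by simp
  qed
  moreover have "m > 0" by (simp add: m_def)
  ultimately show "\<exists>m>0. \<forall>l>0. f ^^ (m + l) = f ^^ m" by blast
next
  assume "\<exists>m>0. \<forall>l>0. f ^^ (m + l) = f ^^ m"
  then obtain m where "f ^^ (m + 1) = f ^^ m"
    using zero_less_one by blast
  then have "f ((f ^^ m) x) = (f ^^ m) x" for x
    by (simp add: fun_eq_iff)
  then show "fixed_point_system f"
    unfolding fixed_point_system_def by blast
qed

theorem theorem33:
  fixes f :: "'a::{field,finite} ^ 'n \<Rightarrow> 'a ^ 'n"
    and q :: nat
    and G :: "('n, 'n \<times> 'n \<times> nat) pre_digraph"
  assumes "q = CARD('a)"
    and "f \<in> MF"
    and "coupled f"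
    and "G = dependency_graph f"
  shows "fixed_point_system f \<longleftrightarrow>
    (\<exists>m::nat. m > 0 \<and>
      (\<forall>a\<in>verts G. \<forall>b\<in>verts G. sequences G m a b \<noteq> {} \<longrightarrow>
        (\<forall>l::nat. l > 0 \<longrightarrow>
          (\<exists>c::int.
            int (num_sequences G (m + l) a b) = int (num_sequences G m a b) + c * (int q - 1) \<and>
            num_sequences G (m + l) a b \<noteq> 0))) \<and>
      (\<forall>a\<in>verts G. \<forall>b\<in>verts G. num_sequences G m a b = 0 \<longrightarrow>
        (\<forall>l::nat. l > 0 \<longrightarrow> num_sequences G (m + l) a b = 0)))"
proof -
  have verts: "verts G = UNIV"
    by (simp add: assms dependency_graph_def)
  \<comment> \<open>Since \<open>card\<close> is 0 on infinite sets too, this needs finiteness of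
    the set of walks.\<close>
  have nonempty: "sequences G m a b \<noteq> {} \<longleftrightarrow> num_sequences G m a b \<noteq> 0" for m a b
    by (simp add: num_sequences_def assms card_gt_0_iff
        fin_digraph.finite_sequences[OF fin_digraph_dependency_graph])
  define P where "P m l a b \<longleftrightarrow> (\<exists>c::int.
      int (num_sequences G (m + l) a b) = int (num_sequences G m a b) + c * (int q - 1) \<and>
      num_sequences G (m + l) a b \<noteq> 0)" for m l a b
  have eq: "f ^^ (m + l) = f ^^ m \<longleftrightarrow>
      (\<forall>a b. (num_sequences G m a b \<noteq> 0 \<longrightarrow> P m l a b) \<and>
        (num_sequences G m a b = 0 \<longrightarrow> num_sequences G (m + l) a b = 0))" for m l
    unfolding funpow_eq_iff[OF assms(2)] reduced_exponent_eq_iff[OF card_field_ge_2] P_def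
      assms(1,4) ..
  \<comment> \<open>After unfolding, both sides differ only in the order of the quantifiers over
    \<open>l\<close> and the vertices and in how the two conditions are grouped.\<close>
  show ?thesis
    unfolding fixed_point_system_iff eq verts nonempty P_def[symmetric] ball_UNIV
    by (intro ex_cong1 conj_cong refl) meson
qed

end
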